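(* Let $\mathbb{K}$ and $\mathbb{K}'$ be finite near-fields with $V=V_{\mathbb{K}}=V_{\mathbb{K}'}$, and let $\mathcal{C}$ and $\mathcal{C}'$ be imprimitive cyclotomic schemes over $\mathbb{K}$ and $\mathbb{K}'$ respectively. Then $\mathcal{C}$ and $\mathcal{C}'$ are isomorphic if and only if their base groups are conjugate in $\mathrm{GL}(V)$. Moreover, if $G$ is the base group of $\mathcal{C}$ and $T$ is the translation group of $V$, then $\overline{G}=G$ and $\mathrm{Aut}(\mathcal{C})=TG$.
   Context: A (right) near-field is $\mathbb{K}=(\mathbb{K},+,\circ)$ such that $\mathbb{K}^+=(\mathbb{K},+)$ is a group with neutral element $0$, $\mathbb{K}^\times=(\mathbb{K}\setminus\{0\},\circ)$ is a group, $x\circ 0=0$ for all $x$, and $(x+y)\circ z=x\circ z+y\circ z$ for all $x,y,z\in\mathbb{K}$. If $\mathbb{K}$ is finite, $\mathbb{K}^+$ is elementary abelian and is identified with the additive group of a linear space $V_{\mathbb{K}}$ over the prime field contained in the center of $\mathbb{K}$. Here $V_{\mathbb K}=V_{\mathbb K'}$ means that the two near-fields have the same underlying set, the same additive group, and hence the same associated linear space. For a subgroup $K\le\mathbb{K}^\times$, the cyclotomic scheme $\mathrm{Cyc}(K,\mathbb{K})$ is the association scheme $(\mathbb{K},\{R_a\}_{a\in\mathbb{K}})$ with $R_a=\{(x,y)\in\mathbb{K}^2: y-x\in a\circ K\}$. Its base group is the subgroup $\{x\mapsto x\circ b: b\in K\}$ of $\mathrm{GL}(V_{\mathbb{K}})$.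 A scheme $(V,\mathcal{R})$ is imprimitive if there is an equivalence relation $E$ on $V$ that is a union of elements of $\mathcal{R}$, with $E$ neither the diagonal nor $V^2$. Schemes $\mathcal{C}=(V,\mathcal{R})$ and $\mathcal{C}'=(V',\mathcal{R}')$ are isomorphic if there is a bijection $f:V\to V'$ with $\{R^f:R\in\mathcal{R}\}=\mathcal{R}'$, where $R^f=\{(u^f,v^f):(u,v)\in R\}$; $\mathrm{Aut}(\mathcal{C})=\{g\in\mathrm{Sym}(V):R^g=R\text{ for all }R\in\mathcal{R}\}$. For $G\le\mathrm{GL}(V)$, the linear closure $\overline{G}$ is the largest subgroup of $\mathrm{GL}(V)$ having the same orbits on $V$ as $G$. The translation group is $T=\{x\mapsto x+c: c\in V\}\le\mathrm{Sym}(V)$. *)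

theory Defs
  imports "HOL-Algebra.Algebra"
begin

section \<open>Near-fields and their linear spaces\<close>

text \<open>A right near-field: only the right distributive law is assumed. Commutativity of addition
  is not an axiom (it is a theorem, at least in the finite case).\<close>

locale near_field =
  fixes K :: "('a, 'm) ring_scheme" (structure)
  assumes add_group: "group (add_monoid K)"
    and m_closed: "\<lbrakk>x \<in> carrier K; y \<in> carrier K\<rbrakk> \<Longrightarrow> x \<otimes> y \<in> carrier K"
    and mult_group: "group (Multiplicative_Group.mult_of K)"
    and r_zero: "x \<in> carrier K \<Longrightarrow> x \<otimes> \<zero> = \<zero>"
    and r_distr: "\<lbrakk>x \<in> carrier K; y \<in> carrier K; z \<in> carrier K\<rbrakk>
      \<Longrightarrow> (x \<oplus> y) \<otimes> z = x \<otimes> z \<oplus> y \<otimes> z"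

definition prime_field :: "('a, 'm) ring_scheme \<Rightarrow> ('a, 'm) ring_scheme" where
  "prime_field K = K\<lparr>carrier := generate_field K {}\<rparr>"

text \<open>The additive group of \<open>K\<close> with scalars acting by left multiplication, to be used with
  \<^term>\<open>prime_field K\<close> as field of scalars. Since the prime field is central in a finite near-field,
  the side of the action is immaterial. The ring multiplication of the record plays no role.\<close>

definition linear_space :: "('a, 'm) ring_scheme \<Rightarrow> ('a, 'a) module" where
  "linear_space K =
    \<lparr>carrier = carrier K, monoid.mult = (\<otimes>\<^bsub>K\<^esub>), one = \<one>\<^bsub>K\<^esub>,
     ring.zero = \<zero>\<^bsub>K\<^esub>, add = (\<oplus>\<^bsub>K\<^esub>), smult = (\<otimes>\<^bsub>K\<^esub>)\<rparr>"

text \<open>Permutations of a set \<open>V\<close> are the elements of \<^term>\<open>BijGroup V\<close>, that is, functions that are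
  \<open>undefined\<close> outside \<open>V\<close>. Its multiplication is composition of functions written on the left of
  their arguments.\<close>

definition GL :: "('f, 'm) ring_scheme \<Rightarrow> ('f, 'v, 'n) module_scheme \<Rightarrow> ('v \<Rightarrow> 'v) monoid" where
  "GL F V = (BijGroup (carrier V))
    \<lparr>carrier := {g \<in> Bij (carrier V).
       (\<forall>x\<in>carrier V. \<forall>y\<in>carrier V. g (x \<oplus>\<^bsub>V\<^esub> y) = g x \<oplus>\<^bsub>V\<^esub> g y) \<and>
       (\<forall>c\<in>carrier F. \<forall>x\<in>carrier V. g (c \<odot>\<^bsub>V\<^esub> x) = c \<odot>\<^bsub>V\<^esub> g x)}\<rparr>"

definition translation_group :: "('a, 'm) ring_scheme \<Rightarrow> ('a \<Rightarrow> 'a) set" where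
  "translation_group V = {\<lambda>x\<in>carrier V. x \<oplus>\<^bsub>V\<^esub> c | c. c \<in> carrier V}"

definition linear_closure ::
    "('f, 'm) ring_scheme \<Rightarrow> ('f, 'v, 'n) module_scheme \<Rightarrow> ('v \<Rightarrow> 'v) set \<Rightarrow> ('v \<Rightarrow> 'v) set" where
  "linear_closure F V G =
    (GREATEST H. subgroup H (GL F V) \<and>
       orbits (GL F V\<lparr>carrier := H\<rparr>) (carrier V) (\<lambda>g. g) =
       orbits (GL F V\<lparr>carrier := G\<rparr>) (carrier V) (\<lambda>g. g))"

definition conjugate_in :: "('g, 'm) monoid_scheme \<Rightarrow> 'g set \<Rightarrow> 'g set \<Rightarrow> bool" where
  "conjugate_in \<G> A B \<longleftrightarrow> (\<exists>h\<in>carrier \<G>. B = h <#\<^bsub>\<G>\<^esub> A #>\<^bsub>\<G>\<^esub> (inv\<^bsub>\<G>\<^esub> h))"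

section \<open>Schemes\<close>

text \<open>A scheme is represented by its point set together with its set of basis relations.\<close>

type_synonym 'a scheme = "'a set \<times> ('a \<times> 'a) set set"

definition imprimitive :: "'a scheme \<Rightarrow> bool" where
  "imprimitive C \<longleftrightarrow>
    (\<exists>E. equiv (fst C) E \<and> (\<exists>S\<subseteq>snd C. E = \<Union>S) \<and> E \<noteq> Id_on (fst C) \<and> E \<noteq> fst C \<times> fst C)"

definition rel_image :: "('a \<Rightarrow> 'b) \<Rightarrow> ('a \<times> 'a) set \<Rightarrow> ('b \<times> 'b) set" where
  "rel_image f R = {(f u, f v) | u v. (u, v) \<in> R}"

definition scheme_isomorphic :: "'a scheme \<Rightarrow> 'b scheme \<Rightarrow> bool" where
  "scheme_isomorphic C C' \<longleftrightarrow>
    (\<exists>f. bij_betw f (fst C) (fst C') \<and> rel_image f ` snd C = snd C')"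

definition scheme_Aut :: "'a scheme \<Rightarrow> ('a \<Rightarrow> 'a) set" where
  "scheme_Aut C = {g \<in> Bij (fst C). \<forall>R\<in>snd C. rel_image g R = R}"

definition cyc_rel :: "'a set \<Rightarrow> ('a, 'm) ring_scheme \<Rightarrow> 'a \<Rightarrow> ('a \<times> 'a) set" where
  "cyc_rel H K a =
    {(x, y). x \<in> carrier K \<and> y \<in> carrier K \<and> y \<ominus>\<^bsub>K\<^esub> x \<in> a <#\<^bsub>K\<^esub> H}"

definition Cyc :: "'a set \<Rightarrow> ('a, 'm) ring_scheme \<Rightarrow> 'a scheme" where
  "Cyc H K = (carrier K, cyc_rel H K ` carrier K)"

definition base_group :: "'a set \<Rightarrow> ('a, 'm) ring_scheme \<Rightarrow> ('a \<Rightarrow> 'a) set" where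
  "base_group H K = {\<lambda>x\<in>carrier K. x \<otimes>\<^bsub>K\<^esub> b | b. b \<in> H}"

end

theory Submission
  imports Defs
begin

text \<open>Let \<open>U\<close> be the class of \<open>0\<close> in a nontrivial equivalence relation of the scheme: an \<open>H\<close>-invariant
  proper nonzero subgroup of the additive group. Since \<open>H\<close> acts semiregularly both on the nonzero
  elements and on the nonzero cosets of \<open>U\<close>, an automorphism fixing \<open>0\<close> and a nonzero
  element of \<open>U\<close> fixes everything outside \<open>U\<close>, and one fixing \<open>0\<close> and an element outside \<open>U\<close> fixes \<open>U\<close>
  pointwise. So the stabilizer of two points is trivial, which determines the automorphism group.
  The translations are then its fixed-point-free elements together with the identity, so an
  isomorphism fixing \<open>0\<close> normalizes them, which makes it additive, and it conjugates the
  stabilizers of \<open>0\<close>, that is, the base groups.\<close>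

section \<open>Subtraction in abelian groups\<close>

context abelian_group begin
lemma minus_eq_zero_iff: "\<lbrakk>x \<in> carrier G; y \<in> carrier G\<rbrakk> \<Longrightarrow> x \<ominus> y = \<zero> \<longleftrightarrow> x = y"
  by (metis a_minus_def a_inv_closed minus_equality minus_minus r_neg)

lemma minus_zero_right: "x \<in> carrier G \<Longrightarrow> x \<ominus> \<zero> = x"
  by (simp add: a_minus_def)

lemma minus_add_cancel: "\<lbrakk>x \<in> carrier G; y \<in> carrier G\<rbrakk> \<Longrightarrow> (x \<ominus> y) \<oplus> y = x"
  by (simp add: a_minus_def a_assoc l_neg)

lemma add_minus_add:
  assumes "x \<in> carrier G" "y \<in> carrier G" "z \<in> carrier G"
  shows "(x \<oplus> z) \<ominus> (y \<oplus> z) = x \<ominus> y"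
proof -
  have "\<ominus> (y \<oplus> z) = \<ominus> z \<oplus> \<ominus> y" using assms by (simp add: minus_add a_comm)
  then show ?thesis using assms by (simp add: a_minus_def a_assoc r_neg2)
qed

text \<open>Separates multiplied from unmultiplied terms: \<open>x - x b = y - y b\<close> becomes
  \<open>x - y = x b - y b\<close>, which exhibits \<open>x - y\<close> as a fixed point of
  multiplication by \<open>b\<close>.\<close>

lemma minus_swap_eq:
  assumes "a \<in> carrier G" "b \<in> carrier G" "c \<in> carrier G" "d \<in> carrier G" "a \<ominus> b = c \<ominus> d"
  shows "a \<ominus> c = b \<ominus> d"
proof -
  have "a = (c \<ominus> d) \<oplus> b" using minus_add_cancel assms by metis
  also have "\<dots> = (b \<ominus> d) \<oplus> c" using assms by (simp add: a_minus_def a_ac)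
  finally show ?thesis using assms by (simp add: a_minus_def a_assoc r_neg)
qed

end

section \<open>Elementary arithmetic of near-fields\<close>

context near_field
begin

interpretation A: group "add_monoid K" by (rule add_group)
interpretation M: group "Multiplicative_Group.mult_of K" by (rule mult_group)

lemma add_closed: "\<lbrakk>x \<in> carrier K; y \<in> carrier K\<rbrakk> \<Longrightarrow> x \<oplus> y \<in> carrier K"
  using A.m_closed by simp

lemma zero_in: "\<zero> \<in> carrier K"
  using A.one_closed by simp

lemma one_in: "\<one> \<in> carrier K"
  using M.one_closed by simp

lemma one_not_zero: "\<one> \<noteq> \<zero>"
  using M.one_closed by simp

lemma add_right_idem: "x \<in> carrier K \<Longrightarrow> x \<oplus> x = x \<Longrightarrow> x = \<zero>"
  using A.r_cancel_one'[of x x] by simp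

lemma l_zero_mult: "x \<in> carrier K \<Longrightarrow> \<zero> \<otimes> x = \<zero>"
  using r_distr[of \<zero> \<zero> x] m_closed[of \<zero> x] zero_in A.l_one[of \<zero>] by (intro add_right_idem) auto

lemma neg_in: "x \<in> carrier K \<Longrightarrow> \<ominus> x \<in> carrier K"
  using A.inv_closed[of x] by (simp add: a_inv_def)

lemma l_neg_mult:
  assumes "x \<in> carrier K" "y \<in> carrier K"
  shows "(\<ominus> x) \<otimes> y = \<ominus> (x \<otimes> y)"
proof -
  have "(\<ominus> x \<oplus> x) \<otimes> y = \<zero>"
    using A.l_inv[of x] l_zero_mult assms by (simp add: a_inv_def)
  then have "(\<ominus> x) \<otimes> y \<oplus> x \<otimes> y = \<zero>"
    using r_distr[of "\<ominus> x" x y] neg_in assms by simp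
  then show ?thesis
    using A.inv_equality[of "(\<ominus> x) \<otimes> y" "x \<otimes> y"] assms neg_in m_closed by (simp add: a_inv_def)
qed

text \<open>The multiplicative group gives associativity and the unit laws for nonzero elements;
  products with a zero factor vanish by \<open>r_zero\<close> and
  \<open>l_zero_mult\<close>.\<close>

sublocale monoid K
proof (rule monoidI)
  fix x y z assume "x \<in> carrier K" "y \<in> carrier K" "z \<in> carrier K"
  then show "(x \<otimes> y) \<otimes> z = x \<otimes> (y \<otimes> z)"
    using M.m_assoc[of x y z] l_zero_mult r_zero m_closed
    by (cases "x = \<zero> \<or> y = \<zero> \<or> z = \<zero>") auto
next
  fix x assume "x \<in> carrier K"
  then show "\<one> \<otimes> x = x" "x \<otimes> \<one> = x"
    using M.l_one[of x] M.r_one[of x] l_zero_mult r_zero one_in by (cases "x = \<zero>"; auto)+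
qed (use m_closed one_in in auto)

lemma Units_eq_nonzero: "Units K = carrier K - {\<zero>}"
proof
  show "Units K \<subseteq> carrier K - {\<zero>}"
    using l_zero_mult one_not_zero r_zero by (auto simp: Units_def)
  show "carrier K - {\<zero>} \<subseteq> Units K"
  proof
    fix x assume "x \<in> carrier K - {\<zero>}"
    then have x: "x \<in> carrier (Multiplicative_Group.mult_of K)" by simp
    from M.l_inv[OF x] M.r_inv[OF x] M.inv_closed[OF x] x show "x \<in> Units K"
      by (auto simp: Units_def)
  qed
qed

end

section \<open>Finite near-fields: commutativity of addition and semiregularity of
  multiplication\<close>

locale finite_near_field = near_field +
  assumes finite_carrier: "finite (carrier K)"
begin

text \<open>Unless \<open>- 1 = 1\<close>, right multiplication by \<open>- 1\<close> is an additive involution without nonzero fixed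
  points, so by finiteness it sends each element to its negative. Hence negation is additive.\<close>

lemma add_comm:
  assumes "x \<in> carrier K" "y \<in> carrier K"
  shows "x \<oplus> y = y \<oplus> x"
proof -
  interpret A: group "add_monoid K" by (rule add_group)
  let ?e = "\<ominus> \<one>"
  have e: "?e \<in> carrier K" using neg_in by simp
  have neg: "?e \<otimes> z = \<ominus> z" if "z \<in> carrier K" for z
    using l_neg_mult[of \<one> z] that by simp
  have negneg: "\<ominus> (\<ominus> z) = z" if "z \<in> carrier K" for z
    using A.inv_inv[of z] that by (simp add: a_inv_def)
  have neg_add: "\<ominus> (a \<oplus> b) = \<ominus> b \<oplus> \<ominus> a" if "a \<in> carrier K" "b \<in> carrier K" for a b
    using A.inv_mult_group[of a b] that by (simp add: a_inv_def)
  have ee: "?e \<otimes> ?e = \<one>" using neg[OF e] negneg by simp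
  have mult_e: "z \<otimes> ?e = \<ominus> z" if z: "z \<in> carrier K" for z
  proof (cases "?e = \<one>")
    case True
    then show ?thesis using neg[of z] z by simp
  next
    case False
    \<comment> \<open>Right multiplication by \<open>?e\<close> negates every value of \<phi>, so it
      suffices that each element is such a value; by finiteness injectivity of \<phi> is
      enough.\<close>
    define \<phi> where "\<phi> = (\<lambda>x. \<ominus> x \<oplus> x \<otimes> ?e)"
    have closed: "\<phi> x \<in> carrier K" if "x \<in> carrier K" for x
      using that e by (simp add: \<phi>_def add_closed neg_in)
    have "inj_on \<phi> (carrier K)"
    proof (rule inj_onI)
      fix x y assume x: "x \<in> carrier K" and y: "y \<in> carrier K" and eq: "\<phi> x = \<phi> y"
      \<comment> \<open>Addition may not be commuted yet. Adding \<open>y\<close> on the left and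
        the negative of \<open>x \<otimes> ?e\<close> on the right turns the equation into a fixed
        point statement for \<open>y \<oplus> \<ominus> x\<close>.\<close>
      have "y \<oplus> \<phi> x \<oplus> \<ominus> (x \<otimes> ?e) = y \<oplus> \<phi> y \<oplus> \<ominus> (x \<otimes> ?e)" using eq by simp
      moreover have "y \<oplus> \<phi> x \<oplus> \<ominus> (x \<otimes> ?e) = y \<oplus> \<ominus> x"
        using x y e A.m_assoc A.r_one[of "\<ominus> x"] A.r_inv[of "x \<otimes> ?e"]
        by (simp add: \<phi>_def add_closed neg_in a_inv_def[symmetric])
      moreover have "y \<oplus> \<phi> y \<oplus> \<ominus> (x \<otimes> ?e) = (y \<oplus> \<ominus> x) \<otimes> ?e"
        using x y e A.r_inv[of y] A.m_assoc[of y "\<ominus> y" "y \<otimes> ?e"] A.l_one[of "y \<otimes> ?e"]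
        by (simp add: \<phi>_def add_closed neg_in a_inv_def[symmetric] r_distr l_neg_mult)
      ultimately have fixed: "(y \<oplus> \<ominus> x) \<otimes> ?e = y \<oplus> \<ominus> x" by simp
      have d: "y \<oplus> \<ominus> x \<in> carrier K" using x y by (simp add: add_closed neg_in)
      have "y \<oplus> \<ominus> x = \<zero>"
      proof (rule ccontr)
        assume "y \<oplus> \<ominus> x \<noteq> \<zero>"
        then have "y \<oplus> \<ominus> x \<in> Units K" using d Units_eq_nonzero by simp
        from Units_l_cancel[OF this e one_closed] fixed d False show False by simp
      qed
      then show "x = y"
        using A.inv_equality[of y "\<ominus> x"] x y neg_in negneg by (simp add: a_inv_def[symmetric])
    qed
    then have "\<phi> ` carrier K = carrier K"
      using closed finite_carrier by (intro endo_inj_surj) auto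
    then obtain x where x: "x \<in> carrier K" and zx: "z = \<phi> x" using z by blast
    have "z \<otimes> ?e = \<ominus> (x \<otimes> ?e) \<oplus> x"
      using x e ee by (simp add: zx \<phi>_def r_distr neg_in l_neg_mult m_assoc)
    also have "\<dots> = \<ominus> z"
      using x e by (simp add: zx \<phi>_def neg_add neg_in negneg)
    finally show ?thesis .
  qed
  \<comment> \<open>Right multiplication by \<open>?e\<close> distributes in the given order,
    whereas inversion in a group reverses the order; comparing the two gives commutativity.\<close>
  have "\<ominus> (x \<oplus> y) = \<ominus> x \<oplus> \<ominus> y"
    using r_distr[OF assms e] mult_e assms add_closed by simp
  also have "\<dots> = \<ominus> (y \<oplus> x)"
    using assms by (simp add: neg_add)
  finally show ?thesis
    using negneg add_closed assms by metis
qed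

sublocale abelian_group K
  by (intro comm_group_abelian_groupI group.group_comm_groupI add_group) (auto simp: add_comm)

lemma l_minus_mult:
  "\<lbrakk>x \<in> carrier K; y \<in> carrier K; z \<in> carrier K\<rbrakk> \<Longrightarrow> (x \<ominus> y) \<otimes> z = x \<otimes> z \<ominus> y \<otimes> z"
  by (simp add: a_minus_def r_distr l_neg_mult neg_in)

text \<open>Nonzero elements are units, so \<open>x\<close> cancels on the left. This is the
  semiregularity of right multiplications on nonzero elements.\<close>

lemma fixed_imp_one:
  assumes "x \<in> carrier K" "b \<in> carrier K" "x \<noteq> \<zero>" "x \<otimes> b = x"
  shows "b = \<one>"
  using Units_l_cancel[of x b \<one>] assms Units_eq_nonzero by simp

text \<open>A collision of \<open>u - u b\<close> would yield a nonzero fixed point of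
  multiplication by \<open>b\<close>, so the map is injective on the finite set \<open>U\<close>,
  hence onto. Equivalently, the affine map sending \<open>x\<close> to \<open>x b + z\<close> has a
  fixed point in \<open>U\<close>.\<close>

lemma one_minus_mult_surj:
  assumes U: "U \<subseteq> carrier K" "\<And>x y. x \<in> U \<Longrightarrow> y \<in> U \<Longrightarrow> x \<ominus> y \<in> U"
    and b: "b \<in> carrier K" "b \<noteq> \<one>" "\<And>u. u \<in> U \<Longrightarrow> u \<otimes> b \<in> U"
    and z: "z \<in> U"
  obtains u where "u \<in> U" "u \<ominus> u \<otimes> b = z"
proof -
  have "inj_on (\<lambda>u. u \<ominus> u \<otimes> b) U"
  proof (rule inj_onI)
    fix x y assume "x \<in> U" "y \<in> U" and eq: "x \<ominus> x \<otimes> b = y \<ominus> y \<otimes> b"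
    then have xy: "x \<in> carrier K" "y \<in> carrier K" using U by auto
    have "(x \<ominus> y) \<otimes> b = x \<ominus> y"
      using minus_swap_eq[OF _ _ _ _ eq] l_minus_mult[OF xy b(1)] xy b by simp
    then have "x \<ominus> y = \<zero>"
      using fixed_imp_one[of "x \<ominus> y" b] xy b by auto
    then show "x = y" using xy by (simp add: minus_eq_zero_iff)
  qed
  then have "(\<lambda>u. u \<ominus> u \<otimes> b) ` U = U"
    using U b finite_subset[OF U(1) finite_carrier] by (intro endo_inj_surj) auto
  with z obtain u where "u \<in> U" "u \<ominus> u \<otimes> b = z" by (force simp del: minus_closed)
  then show thesis by (rule that)
qed

end

section \<open>Cyclotomic schemes and their affine automorphisms\<close>

locale cyclotomic = finite_near_field +
  fixes H
  assumes subgroup_H: "subgroup H (Multiplicative_Group.mult_of K)"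
begin

lemma H_closed: "h \<in> H \<Longrightarrow> h \<in> carrier K"
  and H_one: "\<one> \<in> H"
  and H_mult: "\<lbrakk>h \<in> H; h' \<in> H\<rbrakk> \<Longrightarrow> h \<otimes> h' \<in> H"
  using subgroup.subset[OF subgroup_H] subgroup.one_closed[OF subgroup_H]
    subgroup.m_closed[OF subgroup_H] by auto

lemma H_inverse:
  assumes "h \<in> H"
  obtains h' where "h' \<in> H" "h \<otimes> h' = \<one>" "h' \<otimes> h = \<one>"
proof
  let ?h' = "inv\<^bsub>Multiplicative_Group.mult_of K\<^esub> h"
  have h: "h \<in> carrier (Multiplicative_Group.mult_of K)"
    using assms subgroup.subset[OF subgroup_H] by auto
  show "?h' \<in> H" using subgroup.m_inv_closed[OF subgroup_H assms] .
  show "h \<otimes> ?h' = \<one>" "?h' \<otimes> h = \<one>"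
    using group.r_inv[OF mult_group h] group.l_inv[OF mult_group h] by auto
qed

lemma cyc_rel_iff:
  "(x, y) \<in> cyc_rel H K a \<longleftrightarrow> x \<in> carrier K \<and> y \<in> carrier K \<and> (\<exists>h\<in>H. y \<ominus> x = a \<otimes> h)"
  by (auto simp: cyc_rel_def l_coset_def)

lemma cyc_rel_minus: "\<lbrakk>x \<in> carrier K; y \<in> carrier K\<rbrakk> \<Longrightarrow> (x, y) \<in> cyc_rel H K (y \<ominus> x)"
  using H_one by (auto simp: cyc_rel_iff intro!: bexI[of _ \<one>])

text \<open>The pair \<open>(x, y)\<close> lies in the basis relation indexed by
  \<open>y \<ominus> x\<close>, and \<open>g\<close> maps that relation to itself. The multiplier
  \<open>h\<close> may depend on the pair.\<close>

lemma scheme_AutD: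
  assumes "g \<in> scheme_Aut (Cyc H K)" "x \<in> carrier K" "y \<in> carrier K"
  shows "\<exists>h\<in>H. g y \<ominus> g x = (y \<ominus> x) \<otimes> h"
proof -
  have "rel_image g (cyc_rel H K (y \<ominus> x)) = cyc_rel H K (y \<ominus> x)"
    using assms by (simp add: scheme_Aut_def Cyc_def)
  moreover have "(g x, g y) \<in> rel_image g (cyc_rel H K (y \<ominus> x))"
    using cyc_rel_minus[OF assms(2,3)] by (auto simp: rel_image_def)
  ultimately show ?thesis by (simp add: cyc_rel_iff)
qed

text \<open>The multipliers show only that the image of each relation is contained in it; equality
  follows by counting, since \<open>g\<close> is injective and the carrier is finite.\<close>

lemma scheme_AutI:
  assumes g: "g \<in> Bij (carrier K)"
    and rel: "\<And>x y. \<lbrakk>x \<in> carrier K; y \<in> carrier K\<rbrakk> \<Longrightarrow> \<exists>h\<in>H. g y \<ominus> g x = (y \<ominus> x) \<otimes> h"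
  shows "g \<in> scheme_Aut (Cyc H K)"
proof -
  have bij: "bij_betw g (carrier K) (carrier K)" using g by (simp add: Bij_def)
  have "rel_image g (cyc_rel H K a) = cyc_rel H K a" if a: "a \<in> carrier K" for a
  proof (rule card_seteq[symmetric, THEN sym])
    have sub: "cyc_rel H K a \<subseteq> carrier K \<times> carrier K" by (auto simp: cyc_rel_iff)
    show "finite (cyc_rel H K a)" using sub finite_carrier finite_subset by blast
    have img: "rel_image g (cyc_rel H K a) = map_prod g g ` cyc_rel H K a"
      by (auto simp: rel_image_def)
    have "inj_on (map_prod g g) (cyc_rel H K a)"
      by (rule inj_on_subset[OF map_prod_inj_on sub]) (use bij in \<open>simp_all add: bij_betw_def\<close>)
    then show "card (cyc_rel H K a) \<le> card (rel_image g (cyc_rel H K a))"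
      by (simp add: img card_image)
    show "rel_image g (cyc_rel H K a) \<subseteq> cyc_rel H K a"
    proof
      fix p assume "p \<in> rel_image g (cyc_rel H K a)"
      then obtain x y where p: "p = (g x, g y)" and xy: "(x, y) \<in> cyc_rel H K a"
        by (auto simp: rel_image_def)
      then obtain h where h: "h \<in> H" "y \<ominus> x = a \<otimes> h" "x \<in> carrier K" "y \<in> carrier K"
        by (auto simp: cyc_rel_iff)
      obtain h' where h': "h' \<in> H" "g y \<ominus> g x = (y \<ominus> x) \<otimes> h'" using rel h by blast
      have "g y \<ominus> g x = a \<otimes> (h \<otimes> h')" using h h' a H_closed by (simp add: m_assoc)
      moreover have "g x \<in> carrier K" "g y \<in> carrier K" using g Bij_imp_funcset h by blast+
      ultimately show "p \<in> cyc_rel H K a" using h h' H_mult by (auto simp: p cyc_rel_iff)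
    qed
  qed
  then show ?thesis using g by (simp add: scheme_Aut_def Cyc_def)
qed

lemma affine_Bij:
  assumes b: "b \<in> H" and c: "c \<in> carrier K"
  shows "(\<lambda>x\<in>carrier K. x \<otimes> b \<oplus> c) \<in> Bij (carrier K)"
proof -
  have bc: "b \<in> carrier K" using b H_closed by simp
  obtain b' where b': "b' \<in> H" "b \<otimes> b' = \<one>" using H_inverse[OF b] by blast
  have "inj_on (\<lambda>x\<in>carrier K. x \<otimes> b \<oplus> c) (carrier K)"
  proof (rule inj_onI)
    fix x y assume xy: "x \<in> carrier K" "y \<in> carrier K"
      "(\<lambda>x\<in>carrier K. x \<otimes> b \<oplus> c) x = (\<lambda>x\<in>carrier K. x \<otimes> b \<oplus> c) y"
    then have "x \<otimes> b = y \<otimes> b" using c bc by (auto simp: add.r_cancel)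
    then have "x \<otimes> (b \<otimes> b') = y \<otimes> (b \<otimes> b')" using xy bc b' H_closed by (metis m_assoc)
    then show "x = y" using xy b' by simp
  qed
  moreover have "(\<lambda>x\<in>carrier K. x \<otimes> b \<oplus> c) ` carrier K \<subseteq> carrier K" using c bc by auto
  ultimately show ?thesis
    using finite_carrier by (auto simp: Bij_def bij_betw_def dest: endo_inj_surj)
qed

text \<open>In a difference of two values the summand \<open>c\<close> cancels and \<open>b\<close>
  factors out on the right, so \<open>b\<close> itself is the multiplier for every pair.\<close>

lemma affine_in_scheme_Aut:
  assumes b: "b \<in> H" and c: "c \<in> carrier K"
  shows "(\<lambda>x\<in>carrier K. x \<otimes> b \<oplus> c) \<in> scheme_Aut (Cyc H K)"
  by (rule scheme_AutI[OF affine_Bij[OF b c]])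
     (use b c H_closed in \<open>auto simp: add_minus_add l_minus_mult\<close>)

end

section \<open>Imprimitivity and the triviality of two-point stabilizers\<close>

locale imprimitive_cyclotomic = cyclotomic +
  assumes imprimitive: "imprimitive (Cyc H K)"
begin

lemma invariant_subgroup:
  obtains U where "U \<subseteq> carrier K" "\<zero> \<in> U" "\<And>x y. \<lbrakk>x \<in> U; y \<in> U\<rbrakk> \<Longrightarrow> x \<ominus> y \<in> U"
    "\<And>x h. \<lbrakk>x \<in> U; h \<in> H\<rbrakk> \<Longrightarrow> x \<otimes> h \<in> U" "\<exists>u\<in>U. u \<noteq> \<zero>" "\<exists>v\<in>carrier K. v \<notin> U"
proof -
  from imprimitive obtain E S where E: "equiv (carrier K) E" and S: "S \<subseteq> cyc_rel H K ` carrier K"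
    and ES: "E = \<Union>S" and nId: "E \<noteq> Id_on (carrier K)" and nall: "E \<noteq> carrier K \<times> carrier K"
    unfolding imprimitive_def Cyc_def fst_conv snd_conv by blast
  have Esub: "E \<subseteq> carrier K \<times> carrier K"
    using ES S by (fastforce simp: cyc_rel_def)
  have refl: "(x, x) \<in> E" if "x \<in> carrier K" for x
    using E that by (auto simp: equiv_def refl_on_def)
  have sym: "(y, x) \<in> E" if "(x, y) \<in> E" for x y
    using E that by (auto simp: equiv_def sym_def)
  have trans: "(x, z) \<in> E" if "(x, y) \<in> E" "(y, z) \<in> E" for x y z
    using E that unfolding equiv_def trans_def by blast
  \<comment> \<open>As a union of basis relations, \<open>E\<close> depends only on differences up
    to right multiplication by \<open>H\<close>. The case \<open>h = \<one>\<close> is translation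
    invariance.\<close>
  have inv: "(x', y') \<in> E" if xy: "(x, y) \<in> E" and c: "x' \<in> carrier K" "y' \<in> carrier K"
    and h: "h \<in> H" and eq: "y' \<ominus> x' = (y \<ominus> x) \<otimes> h" for x y x' y' h
  proof -
    from xy ES S obtain a where a: "a \<in> carrier K" "cyc_rel H K a \<in> S" "(x, y) \<in> cyc_rel H K a"
      by blast
    then obtain k where k: "k \<in> H" "y \<ominus> x = a \<otimes> k" by (auto simp: cyc_rel_iff)
    then have "y' \<ominus> x' = a \<otimes> (k \<otimes> h)" using eq a h H_closed by (simp add: m_assoc)
    then have "(x', y') \<in> cyc_rel H K a" using c k h H_mult by (auto simp: cyc_rel_iff)
    then show ?thesis using a ES by blast
  qed
  have inv1: "(x', y') \<in> E" if "(x, y) \<in> E" "x' \<in> carrier K" "y' \<in> carrier K" "y' \<ominus> x' = y \<ominus> x"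
    for x y x' y'
    using inv[OF that(1-3) H_one] that Esub by auto
  define U where "U = {x \<in> carrier K. (\<zero>, x) \<in> E}"
  \<comment> \<open>By translation invariance the classes of \<open>E\<close> are the cosets of
    \<open>U\<close>. Each property of \<open>U\<close> is then read off from a property of the
    equivalence relation.\<close>
  have mem: "y \<ominus> x \<in> U \<longleftrightarrow> (x, y) \<in> E" if "x \<in> carrier K" "y \<in> carrier K" for x y
    using that inv1[of x y \<zero> "y \<ominus> x"] inv1[of \<zero> "y \<ominus> x" x y]
    by (auto simp: U_def minus_zero_right)
  show thesis
  proof
    show "U \<subseteq> carrier K" "\<zero> \<in> U" using refl by (auto simp: U_def)
    show "x \<ominus> y \<in> U" if "x \<in> U" "y \<in> U" for x y
      using that mem[of y x] sym trans unfolding U_def by blast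
    show "x \<otimes> h \<in> U" if "x \<in> U" "h \<in> H" for x h
      using that inv[of \<zero> x \<zero> "x \<otimes> h" h] H_closed by (auto simp: U_def minus_zero_right)
    have "Id_on (carrier K) \<subseteq> E" using refl by auto
    with nId obtain p where "p \<in> E" "p \<notin> Id_on (carrier K)" by blast
    with Esub obtain x y where xy: "(x, y) \<in> E" "x \<noteq> y" "x \<in> carrier K" "y \<in> carrier K"
      by (cases p) auto
    then show "\<exists>u\<in>U. u \<noteq> \<zero>" using mem minus_eq_zero_iff by blast
    from nall Esub obtain x y where "(x, y) \<notin> E" "x \<in> carrier K" "y \<in> carrier K" by blast
    then show "\<exists>v\<in>carrier K. v \<notin> U" using mem minus_closed by blast
  qed
qed

text \<open>An automorphism fixing zero multiplies every point by some element of \<open>H\<close>.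
  Comparing a point inside \<open>U\<close> with one outside, of which one is fixed, forces the
  multiplier of the other to be one; \<open>out\<close> and \<open>ins\<close> treat the two
  directions.\<close>

lemma scheme_Aut_fixing_two_points:
  assumes g: "g \<in> scheme_Aut (Cyc H K)" and g0: "g \<zero> = \<zero>"
    and w: "w \<in> carrier K" "w \<noteq> \<zero>" "g w = w" and x: "x \<in> carrier K"
  shows "g x = x"
proof -
  obtain U where U: "U \<subseteq> carrier K" "\<zero> \<in> U" "\<And>x y. \<lbrakk>x \<in> U; y \<in> U\<rbrakk> \<Longrightarrow> x \<ominus> y \<in> U"
    "\<And>x h. \<lbrakk>x \<in> U; h \<in> H\<rbrakk> \<Longrightarrow> x \<otimes> h \<in> U" and nz: "\<exists>u\<in>U. u \<noteq> \<zero>"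
    and nU: "\<exists>v\<in>carrier K. v \<notin> U"
    by (rule invariant_subgroup) blast
  \<comment> \<open>\<open>H\<close> acts semiregularly on the nonzero vectors of the quotient by \<open>U\<close>.\<close>
  have quot: "h = \<one>" if v: "v \<in> carrier K" "v \<notin> U" and h: "h \<in> H" and d: "v \<ominus> v \<otimes> h \<in> U" for v h
  proof (rule ccontr)
    assume "h \<noteq> \<one>"
    \<comment> \<open>This \<open>u\<close> corrects \<open>v\<close> to a representative
      \<open>v \<ominus> u\<close> of the same coset that is fixed by \<open>h\<close>; it is
      nonzero because \<open>v\<close> lies outside \<open>U\<close>.\<close>
    then obtain u where u: "u \<in> U" "u \<ominus> u \<otimes> h = v \<ominus> v \<otimes> h"
      using one_minus_mult_surj[of U h] U h d H_closed by metis
    have uc: "u \<in> carrier K" using u U by blast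
    have hc: "h \<in> carrier K" using h H_closed by blast
    have "(v \<ominus> u) \<otimes> h = v \<ominus> u"
      using minus_swap_eq[of v "v \<otimes> h" u "u \<otimes> h"] l_minus_mult[OF v(1) uc hc] u v uc hc by simp
    then have "v \<ominus> u = \<zero>"
      using fixed_imp_one[of "v \<ominus> u" h] v uc hc \<open>h \<noteq> \<one>\<close> by auto
    then show False using minus_eq_zero_iff uc u v by auto
  qed
  \<comment> \<open>Right multiplication by the inverse of \<open>h\<close> preserves
    \<open>U\<close> and reduces this to \<open>quot\<close>.\<close>
  have quot2: "h = k" if v: "v \<in> carrier K" "v \<notin> U" and h: "h \<in> H" "k \<in> H"
    and d: "v \<otimes> h \<ominus> v \<otimes> k \<in> U" for v h k
  proof -
    obtain h' where h': "h' \<in> H" "h \<otimes> h' = \<one>" "h' \<otimes> h = \<one>" using H_inverse[OF h(1)] by blast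
    have c: "h \<in> carrier K" "k \<in> carrier K" "h' \<in> carrier K" using h h' H_closed by auto
    have "(v \<otimes> h \<ominus> v \<otimes> k) \<otimes> h' \<in> U" using d U h' by blast
    moreover have "(v \<otimes> h \<ominus> v \<otimes> k) \<otimes> h' = v \<ominus> v \<otimes> (k \<otimes> h')"
      using c v h' by (simp add: l_minus_mult m_assoc)
    ultimately have "k \<otimes> h' = \<one>" using quot v h h' H_mult by metis
    then have "(k \<otimes> h') \<otimes> h = h" using c by simp
    then show ?thesis using c h' by (simp add: m_assoc)
  qed
  have gc: "g y \<in> carrier K" if "y \<in> carrier K" for y
    using g that Bij_imp_funcset by (fastforce simp: scheme_Aut_def Cyc_def)
  have img: "\<exists>h\<in>H. g y = y \<otimes> h" if "y \<in> carrier K" for y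
    using scheme_AutD[OF g _ that, of \<zero>] that gc g0 by (auto simp: minus_zero_right)
  have out: "g v = v" if u: "u \<in> U" "u \<noteq> \<zero>" "g u = u" and v: "v \<in> carrier K" "v \<notin> U" for u v
  proof -
    have uc: "u \<in> carrier K" using u U by blast
    obtain h where h: "h \<in> H" "g v = v \<otimes> h" using img v by blast
    obtain k where k: "k \<in> H" "g v \<ominus> g u = (v \<ominus> u) \<otimes> k" using scheme_AutD[OF g uc v(1)] by blast
    have c: "h \<in> carrier K" "k \<in> carrier K" using h k H_closed by auto
    \<comment> \<open>The right-hand side lies in \<open>U\<close>, so \<open>h\<close> and
      \<open>k\<close> agree on the coset of \<open>v\<close> and are equal; the left-hand side then
      vanishes, which makes \<open>k\<close> fix \<open>u\<close>.\<close>
    have eq: "v \<otimes> h \<ominus> v \<otimes> k = u \<ominus> u \<otimes> k"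
      using k c uc v h u minus_swap_eq[of "v \<otimes> h" u "v \<otimes> k" "u \<otimes> k"] by (simp add: l_minus_mult)
    then have hk: "h = k" using quot2[OF v h(1) k(1)] u k U by simp
    then have "u \<otimes> k = u" using eq c v uc minus_eq_zero_iff[of "v \<otimes> k" "v \<otimes> k"]
        minus_eq_zero_iff[of u "u \<otimes> k"] by simp
    then have "k = \<one>" using fixed_imp_one uc u c by blast
    then show ?thesis using h hk v by simp
  qed
  have ins: "g u = u" if u: "u \<in> U" and v: "v \<in> carrier K" "v \<notin> U" "g v = v" for u v
  proof -
    have uc: "u \<in> carrier K" using u U by blast
    obtain h where h: "h \<in> H" "g u = u \<otimes> h" using img uc by blast
    obtain k where k: "k \<in> H" "g v \<ominus> g u = (v \<ominus> u) \<otimes> k" using scheme_AutD[OF g uc v(1)] by blast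
    have c: "h \<in> carrier K" "k \<in> carrier K" using h k H_closed by auto
    have eq: "v \<ominus> v \<otimes> k = u \<otimes> h \<ominus> u \<otimes> k"
      using k c uc v h u minus_swap_eq[of v "u \<otimes> h" "v \<otimes> k" "u \<otimes> k"] by (simp add: l_minus_mult)
    \<comment> \<open>Here too the right-hand side of \<open>eq\<close> lies in \<open>U\<close>, so
      \<open>k\<close> fixes the coset of \<open>v\<close>.\<close>
    then have "k = \<one>" using quot[OF v(1,2) k(1)] u k h U by simp
    then have "u \<otimes> h \<ominus> u = \<zero>" using eq v uc minus_eq_zero_iff[of v v] by simp
    then show ?thesis using h c uc minus_eq_zero_iff[of "u \<otimes> h" u] by simp
  qed
  \<comment> \<open>Wherever \<open>w\<close> lies, there is a fixed point outside \<open>U\<close>.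
    It makes all of \<open>U\<close> fixed by \<open>ins\<close>, and a nonzero element of
    \<open>U\<close> then makes the complement fixed by \<open>out\<close>.\<close>
  obtain v where v: "v \<in> carrier K" "v \<notin> U" "g v = v"
    using out[OF _ w(2,3)] w nU by (cases "w \<in> U") auto
  obtain u where "u \<in> U" "u \<noteq> \<zero>" "g u = u" using nz ins[OF _ v] by blast
  then show ?thesis using out ins[OF _ v] x by (cases "x \<in> U") auto
qed

end

section \<open>Images of relations and conjugation of scheme automorphisms\<close>

lemma rel_image_eq_image: "rel_image f R = map_prod f f ` R"
  by (auto simp: rel_image_def)

lemma rel_image_comp: "rel_image g (rel_image f R) = rel_image (g \<circ> f) R"
  by (simp add: rel_image_eq_image image_image map_prod_def split_def)

lemma rel_image_cong:
  assumes "R \<subseteq> A \<times> A" "\<And>x. x \<in> A \<Longrightarrow> f x = g x"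
  shows "rel_image f R = rel_image g R"
  unfolding rel_image_eq_image by (rule image_cong) (use assms in auto)

lemma rel_image_ident: "R \<subseteq> A \<times> A \<Longrightarrow> (\<And>x. x \<in> A \<Longrightarrow> f x = x) \<Longrightarrow> rel_image f R = R"
  using rel_image_cong[of R A f "\<lambda>x. x"] by (auto simp: rel_image_def)

lemma rel_image_inv_into:
  assumes f: "bij_betw f (fst C) (fst C')" "rel_image f ` snd C = snd C'"
    and sub: "\<And>R. R \<in> snd C \<Longrightarrow> R \<subseteq> fst C \<times> fst C"
  shows "rel_image (inv_into (fst C) f) ` snd C' = snd C"
proof -
  have "rel_image (inv_into (fst C) f) (rel_image f R) = R" if "R \<in> snd C" for R
    unfolding rel_image_comp using sub[OF that] f(1)
    by (intro rel_image_ident[of R "fst C"]) (auto simp: bij_betw_inv_into_left)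
  then show ?thesis unfolding f(2)[symmetric] image_image by simp
qed

text \<open>Each relation of \<open>C'\<close> is the image under \<open>f\<close> of a relation
  that \<open>g\<close> preserves. The restriction makes the conjugate \<open>undefined\<close> off
  the point set, as \<open>Bij\<close> demands.\<close>

lemma scheme_Aut_conj:
  assumes f: "bij_betw f (fst C) (fst C')" "rel_image f ` snd C = snd C'"
    and sub: "\<And>R. R \<in> snd C \<Longrightarrow> R \<subseteq> fst C \<times> fst C"
    and g: "g \<in> scheme_Aut C"
  shows "(\<lambda>x\<in>fst C'. f (g (inv_into (fst C) f x))) \<in> scheme_Aut C'" (is "?g \<in> _")
proof -
  have gb: "bij_betw g (fst C) (fst C)" using g by (simp add: scheme_Aut_def Bij_def)
  have "bij_betw (f \<circ> (g \<circ> inv_into (fst C) f)) (fst C') (fst C')"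
    using bij_betw_trans[OF bij_betw_trans[OF bij_betw_inv_into[OF f(1)] gb] f(1)]
    by (simp add: comp_assoc)
  then have "bij_betw ?g (fst C') (fst C')"
    by (rule bij_betw_cong[THEN iffD1, rotated]) simp
  moreover have "rel_image ?g (rel_image f R) = rel_image f R" if R: "R \<in> snd C" for R
  proof -
    have "rel_image ?g (rel_image f R) = rel_image (f \<circ> g) R"
      unfolding rel_image_comp using sub[OF R] f(1)
      by (intro rel_image_cong[of R "fst C"])
        (auto simp: bij_betw_inv_into_left bij_betwE)
    also have "\<dots> = rel_image f (rel_image g R)" by (simp add: rel_image_comp)
    also have "\<dots> = rel_image f R" using g R by (simp add: scheme_Aut_def)
    finally show ?thesis .
  qed
  moreover have "\<forall>R\<in>snd C'. rel_image ?g R = R"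
    unfolding f(2)[symmetric] using calculation(2) by blast
  ultimately show ?thesis by (simp add: scheme_Aut_def Bij_def)
qed

section \<open>The prime field and the general linear group\<close>

lemma prime_field_in_carrier:
  assumes "near_field K" "c \<in> generate_field K {}"
  shows "c \<in> carrier K"
proof -
  interpret near_field K by (rule assms)
  show ?thesis
    using assms(2)
  proof induction
    case (m_inv h)
    then show ?case using Units_eq_nonzero by (metis DiffI Units_inv_closed singletonD)
  qed (auto simp: neg_in add_closed)
qed

context near_field
begin

lemma additive_neg:
  assumes g: "g \<in> carrier K \<rightarrow> carrier K"
    and add: "\<And>x y. \<lbrakk>x \<in> carrier K; y \<in> carrier K\<rbrakk> \<Longrightarrow> g (x \<oplus> y) = g x \<oplus> g y"
    and x: "x \<in> carrier K"
  shows "g (\<ominus> x) = \<ominus> g x"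
proof -
  have "g \<in> hom (add_monoid K) (add_monoid K)" using g add by (auto simp: hom_def)
  then show ?thesis
    using group_hom.hom_inv[of "add_monoid K" "add_monoid K" g x] x add_group
    by (simp add: group_hom_def group_hom_axioms_def a_inv_def)
qed

text \<open>Induction on the generation of the scalar from one. Scalars stand on the left, so
  \<open>r_distr\<close> splits a sum of scalars.\<close>

lemma additive_prime_field_linear:
  assumes g: "g \<in> carrier K \<rightarrow> carrier K"
    and add: "\<And>x y. \<lbrakk>x \<in> carrier K; y \<in> carrier K\<rbrakk> \<Longrightarrow> g (x \<oplus> y) = g x \<oplus> g y"
    and c: "c \<in> generate_field K {}" and x: "x \<in> carrier K"
  shows "g (c \<otimes> x) = c \<otimes> g x"
  using c x
proof (induction arbitrary: x)
  case one
  then show ?case using l_one[of "g x"] g by (auto simp: Pi_iff)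
next
  case (a_inv h)
  then show ?case
    using prime_field_in_carrier[OF near_field_axioms a_inv.hyps] additive_neg[OF g add] g
    by (simp add: l_neg_mult Pi_iff)
next
  case (m_inv h)
  have h: "h \<in> Units K"
    using prime_field_in_carrier[OF near_field_axioms m_inv.hyps(1)] m_inv.hyps Units_eq_nonzero
    by simp
  then have hc: "h \<in> carrier K" "inv h \<in> carrier K" by auto
  have gx: "g x \<in> carrier K" "g (inv h \<otimes> x) \<in> carrier K" using g m_inv.prems hc by auto
  \<comment> \<open>The induction hypothesis for \<open>h\<close> is applied at
    \<open>inv h \<otimes> x\<close>; multiplying by \<open>inv h\<close> then gives the claim for
    the inverse scalar.\<close>
  have "h \<otimes> g (inv h \<otimes> x) = g (h \<otimes> (inv h \<otimes> x))"
    using m_inv.IH[of "inv h \<otimes> x"] m_inv.prems hc by simp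
  also have "h \<otimes> (inv h \<otimes> x) = x"
    using h hc m_inv.prems by (simp flip: m_assoc)
  finally have "inv h \<otimes> g x = inv h \<otimes> (h \<otimes> g (inv h \<otimes> x))" by simp
  also have "\<dots> = g (inv h \<otimes> x)"
    using h hc gx by (simp flip: m_assoc)
  finally show ?case by simp
next
  case (eng_add h1 h2)
  then show ?case
    using prime_field_in_carrier[OF near_field_axioms] add g by (simp add: r_distr Pi_iff)
next
  case (eng_mult h1 h2)
  then show ?case
    using prime_field_in_carrier[OF near_field_axioms] g by (simp add: m_assoc Pi_iff)
qed auto

text \<open>Linearity over the prime field follows from additivity, so later arguments can work with
  automorphisms of the additive group.\<close>

lemma GL_eq_AutoGroup: "GL (prime_field K) (linear_space K) = AutoGroup (add_monoid K)"
proof -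
  have "{g \<in> Bij (carrier K). (\<forall>x\<in>carrier K. \<forall>y\<in>carrier K. g (x \<oplus> y) = g x \<oplus> g y) \<and>
      (\<forall>c\<in>generate_field K {}. \<forall>x\<in>carrier K. g (c \<otimes> x) = c \<otimes> g x)} = auto (add_monoid K)"
    by (auto simp: auto_def hom_def dest: Bij_imp_funcset
        intro!: additive_prime_field_linear)
  then show ?thesis
    by (simp add: GL_def AutoGroup_def linear_space_def prime_field_def)
qed

end

section \<open>Composition of automorphisms and the base group as a linear group\<close>

context cyclotomic
begin

lemma cyc_rel_subset: "R \<in> snd (Cyc H K) \<Longrightarrow> R \<subseteq> fst (Cyc H K) \<times> fst (Cyc H K)"
  by (auto simp: Cyc_def cyc_rel_def)

lemma scheme_Aut_compose:
  assumes f: "f \<in> scheme_Aut (Cyc H K)" and g: "g \<in> scheme_Aut (Cyc H K)"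
  shows "compose (carrier K) f g \<in> scheme_Aut (Cyc H K)"
proof (rule scheme_AutI)
  have B: "f \<in> Bij (carrier K)" "g \<in> Bij (carrier K)"
    using f g by (auto simp: scheme_Aut_def Cyc_def)
  then show "compose (carrier K) f g \<in> Bij (carrier K)" by (rule compose_Bij)
  fix x y assume xy: "x \<in> carrier K" "y \<in> carrier K"
  obtain h where h: "h \<in> H" "g y \<ominus> g x = (y \<ominus> x) \<otimes> h" using scheme_AutD[OF g xy] by blast
  have "g x \<in> carrier K" "g y \<in> carrier K" using Bij_imp_funcset[OF B(2)] xy by auto
  from scheme_AutD[OF f this] obtain k where k: "k \<in> H" "f (g y) \<ominus> f (g x) = (g y \<ominus> g x) \<otimes> k"
    by blast
  have "f (g y) \<ominus> f (g x) = (y \<ominus> x) \<otimes> (h \<otimes> k)"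
    using h k xy H_closed by (simp add: m_assoc)
  then show "\<exists>h\<in>H. compose (carrier K) f g y \<ominus> compose (carrier K) f g x = (y \<ominus> x) \<otimes> h"
    using H_mult h k xy by (auto simp: compose_eq)
qed

lemma right_mult_in_auto:
  assumes "b \<in> H"
  shows "(\<lambda>x\<in>carrier K. x \<otimes> b) \<in> auto (add_monoid K)"
proof -
  have "(\<lambda>x\<in>carrier K. x \<otimes> b) = (\<lambda>x\<in>carrier K. x \<otimes> b \<oplus> \<zero>)"
    using assms H_closed by (auto simp: restrict_def)
  then show ?thesis
    using affine_Bij[OF assms zero_in] H_closed[OF assms] by (auto simp: auto_def hom_def r_distr)
qed

lemma subgroup_base_group: "subgroup (base_group H K) (AutoGroup (add_monoid K))"
proof (rule group.subgroupI[OF group.AutoGroup[OF add_group]])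
  show "base_group H K \<subseteq> carrier (AutoGroup (add_monoid K))"
    using right_mult_in_auto by (auto simp: base_group_def AutoGroup_def)
  show "base_group H K \<noteq> {}" using H_one by (auto simp: base_group_def)
next
  \<comment> \<open>Composition is written on the left while \<open>H\<close> acts on the right, so
    the factors appear in reverse order.\<close>
  have mult: "(\<lambda>x\<in>carrier K. x \<otimes> b) \<otimes>\<^bsub>AutoGroup (add_monoid K)\<^esub> (\<lambda>x\<in>carrier K. x \<otimes> c)
      = (\<lambda>x\<in>carrier K. x \<otimes> (c \<otimes> b))" if "b \<in> H" "c \<in> H" for b c
    using right_mult_in_auto[OF that(1)] right_mult_in_auto[OF that(2)] that H_closed
    by (auto simp: AutoGroup_def BijGroup_def auto_def compose_def m_assoc intro!: restrict_ext)
  show "f \<otimes>\<^bsub>AutoGroup (add_monoid K)\<^esub> g \<in> base_group H K"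
    if "f \<in> base_group H K" "g \<in> base_group H K" for f g
    using that mult H_mult unfolding base_group_def by fastforce
  show "inv\<^bsub>AutoGroup (add_monoid K)\<^esub> f \<in> base_group H K" if "f \<in> base_group H K" for f
  proof -
    from that obtain b where b: "b \<in> H" "f = (\<lambda>x\<in>carrier K. x \<otimes> b)" by (auto simp: base_group_def)
    obtain b' where b': "b' \<in> H" "b \<otimes> b' = \<one>" using H_inverse[OF b(1)] by blast
    have "(\<lambda>x\<in>carrier K. x \<otimes> b') \<otimes>\<^bsub>AutoGroup (add_monoid K)\<^esub> f = \<one>\<^bsub>AutoGroup (add_monoid K)\<^esub>"
      using mult[OF b'(1) b(1)] b' b
      by (auto simp: AutoGroup_def BijGroup_def intro!: restrict_ext)
    then have "inv\<^bsub>AutoGroup (add_monoid K)\<^esub> f = (\<lambda>x\<in>carrier K. x \<otimes> b')"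
      using right_mult_in_auto b b'
      by (intro group.inv_equality[OF group.AutoGroup[OF add_group]]) (auto simp: AutoGroup_def)
    then show ?thesis using b' by (auto simp: base_group_def)
  qed
qed

end

section \<open>The automorphism group and the linear closure of the base group\<close>

context imprimitive_cyclotomic
begin

text \<open>An automorphism agrees at zero and one with some affine map; composing it with the
  inverse of that map leaves an automorphism fixing two points, hence the identity.\<close>

lemma scheme_Aut_eq_affine:
  "scheme_Aut (Cyc H K) = {\<lambda>x\<in>carrier K. x \<otimes> b \<oplus> c | b c. b \<in> H \<and> c \<in> carrier K}"
proof
  show "{\<lambda>x\<in>carrier K. x \<otimes> b \<oplus> c | b c. b \<in> H \<and> c \<in> carrier K} \<subseteq> scheme_Aut (Cyc H K)"
    using affine_in_scheme_Aut by auto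
  show "scheme_Aut (Cyc H K) \<subseteq> {\<lambda>x\<in>carrier K. x \<otimes> b \<oplus> c | b c. b \<in> H \<and> c \<in> carrier K}"
  proof
    fix g assume g: "g \<in> scheme_Aut (Cyc H K)"
    then have B: "g \<in> Bij (carrier K)" by (simp add: scheme_Aut_def Cyc_def)
    have gc: "g x \<in> carrier K" if "x \<in> carrier K" for x using Bij_imp_funcset[OF B] that by auto
    define c where "c = g \<zero>"
    have c: "c \<in> carrier K" using gc by (simp add: c_def)
    obtain b where b: "b \<in> H" "g \<one> \<ominus> c = (\<one> \<ominus> \<zero>) \<otimes> b"
      unfolding c_def using scheme_AutD[OF g, of \<zero> \<one>] by auto
    obtain b' where b': "b' \<in> H" "b \<otimes> b' = \<one>" "b' \<otimes> b = \<one>" using H_inverse[OF b(1)] by blast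
    have bc: "b \<in> carrier K" "b' \<in> carrier K" using b b' H_closed by auto
    \<comment> \<open>The outer map sends \<open>x\<close> to
      \<open>(x \<ominus> c) \<otimes> b'\<close>, expanded into the shape covered by
      \<open>affine_in_scheme_Aut\<close>.\<close>
    define f where "f = compose (carrier K) (\<lambda>x\<in>carrier K. x \<otimes> b' \<oplus> (\<ominus> c) \<otimes> b') g"
    have f: "f \<in> scheme_Aut (Cyc H K)"
      unfolding f_def using b' bc c by (intro scheme_Aut_compose affine_in_scheme_Aut g) auto
    have fx: "f x = (g x \<ominus> c) \<otimes> b'" if "x \<in> carrier K" for x
      using that gc c bc by (simp add: f_def compose_eq a_minus_def r_distr)
    have "f \<zero> = \<zero>" using fx c bc by (simp add: c_def[symmetric] minus_eq_zero_iff[THEN iffD2] l_zero_mult)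
    moreover have "f \<one> = \<one>" using fx[OF one_closed] b b' bc by (simp add: minus_zero_right)
    ultimately have fid: "f x = x" if "x \<in> carrier K" for x
      using scheme_Aut_fixing_two_points[OF f, of \<one> x] that one_not_zero by simp
    have "g x = x \<otimes> b \<oplus> c" if x: "x \<in> carrier K" for x
    proof -
      have "x \<otimes> b = ((g x \<ominus> c) \<otimes> b') \<otimes> b" using fx fid x by simp
      also have "\<dots> = g x \<ominus> c" using x gc c bc b' by (simp add: m_assoc)
      finally show ?thesis using minus_add_cancel gc x c by simp
    qed
    then have "g = (\<lambda>x\<in>carrier K. x \<otimes> b \<oplus> c)"
      using Bij_imp_extensional[OF B] by (auto simp: extensional_def)
    then show "g \<in> {\<lambda>x\<in>carrier K. x \<otimes> b \<oplus> c | b c. b \<in> H \<and> c \<in> carrier K}" using b c by blast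
  qed
qed

text \<open>An affine map sends zero to its translation part. This describes the base group through
  the scheme and the point zero, so that isomorphisms fixing zero can transport it.\<close>

lemma base_group_eq_stabilizer: "base_group H K = {g \<in> scheme_Aut (Cyc H K). g \<zero> = \<zero>}"
proof (intro equalityI subsetI)
  have lin: "(\<lambda>x\<in>carrier K. x \<otimes> b \<oplus> \<zero>) = (\<lambda>x\<in>carrier K. x \<otimes> b)" if "b \<in> H" for b
    using that H_closed by (auto intro!: restrict_ext)
  fix g
  {
    assume "g \<in> base_group H K"
    then obtain b where b: "b \<in> H" "g = (\<lambda>x\<in>carrier K. x \<otimes> b)" by (auto simp: base_group_def)
    then show "g \<in> {g \<in> scheme_Aut (Cyc H K). g \<zero> = \<zero>}"
      using affine_in_scheme_Aut[OF b(1) zero_in] lin H_closed by (simp add: l_zero_mult)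
  next
    assume "g \<in> {g \<in> scheme_Aut (Cyc H K). g \<zero> = \<zero>}"
    then obtain b c where bc: "b \<in> H" "c \<in> carrier K" "g = (\<lambda>x\<in>carrier K. x \<otimes> b \<oplus> c)"
      and "g \<zero> = \<zero>" unfolding scheme_Aut_eq_affine by blast
    then have "c = \<zero>" using H_closed by (simp add: l_zero_mult)
    then show "g \<in> base_group H K" using bc lin by (auto simp: base_group_def)
  }
qed

lemma scheme_Aut_eq_set_mult:
  "scheme_Aut (Cyc H K) = translation_group (linear_space K) <#>\<^bsub>BijGroup (carrier K)\<^esub> base_group H K"
proof -
  have "(\<lambda>x\<in>carrier K. x \<oplus> c) \<otimes>\<^bsub>BijGroup (carrier K)\<^esub> (\<lambda>x\<in>carrier K. x \<otimes> b)
      = (\<lambda>x\<in>carrier K. x \<otimes> b \<oplus> c)" if "b \<in> H" "c \<in> carrier K" for b c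
  proof -
    have "(\<lambda>x\<in>carrier K. x \<oplus> c) = (\<lambda>x\<in>carrier K. x \<otimes> \<one> \<oplus> c)" by (auto intro!: restrict_ext)
    then have "(\<lambda>x\<in>carrier K. x \<oplus> c) \<in> Bij (carrier K)" using affine_Bij[OF H_one that(2)] by simp
    moreover have "(\<lambda>x\<in>carrier K. x \<otimes> b) \<in> Bij (carrier K)"
      using right_mult_in_auto[OF that(1)] by (simp add: auto_def)
    ultimately show ?thesis
      using that H_closed by (auto simp: BijGroup_def compose_def intro!: restrict_ext)
  qed
  then show ?thesis
    unfolding scheme_Aut_eq_affine translation_group_def base_group_def set_mult_def
    by (fastforce simp: linear_space_def)
qed

text \<open>A linear map with values in the orbits of the base group multiplies each difference by
  an element of \<open>H\<close>. It therefore preserves every basis relation, and it fixes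
  zero.\<close>

lemma linear_closure_base_group:
  "linear_closure (prime_field K) (linear_space K) (base_group H K) = base_group H K"
  unfolding linear_closure_def GL_eq_AutoGroup
proof (rule Greatest_equality)
  let ?A = "AutoGroup (add_monoid K)"
  have car: "carrier (linear_space K) = carrier K" by (simp add: linear_space_def)
  show "subgroup (base_group H K) ?A \<and> orbits (?A\<lparr>carrier := base_group H K\<rparr>) (carrier (linear_space K)) (\<lambda>g. g) =
       orbits (?A\<lparr>carrier := base_group H K\<rparr>) (carrier (linear_space K)) (\<lambda>g. g)"
    using subgroup_base_group by simp
  fix L assume "subgroup L ?A \<and> orbits (?A\<lparr>carrier := L\<rparr>) (carrier (linear_space K)) (\<lambda>g. g) =
       orbits (?A\<lparr>carrier := base_group H K\<rparr>) (carrier (linear_space K)) (\<lambda>g. g)"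
  then have L: "subgroup L ?A" and orb: "orbits (?A\<lparr>carrier := L\<rparr>) (carrier K) (\<lambda>g. g) =
       orbits (?A\<lparr>carrier := base_group H K\<rparr>) (carrier K) (\<lambda>g. g)" by (auto simp: car)
  show "L \<subseteq> base_group H K"
  proof
    fix g assume g: "g \<in> L"
    then have ga: "g \<in> auto (add_monoid K)" using subgroup.subset[OF L] by (auto simp: AutoGroup_def)
    then have B: "g \<in> Bij (carrier K)" by (simp add: auto_def)
    have gc: "g x \<in> carrier K" if "x \<in> carrier K" for x using Bij_imp_funcset[OF B] that by auto
    have gadd: "g (x \<oplus> y) = g x \<oplus> g y" if "x \<in> carrier K" "y \<in> carrier K" for x y
      using ga that by (auto simp: auto_def hom_def)
    have gminus: "g (y \<ominus> x) = g y \<ominus> g x" if "x \<in> carrier K" "y \<in> carrier K" for x y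
      using that gadd additive_neg[of g x] gc by (simp add: a_minus_def)
    have img: "\<exists>h\<in>H. g z = z \<otimes> h" if z: "z \<in> carrier K" for z
    proof -
      let ?O = "orbit (?A\<lparr>carrier := L\<rparr>) (\<lambda>g. g) z"
      have "(\<lambda>x\<in>carrier K. x) \<in> L"
        using subgroup.one_closed[OF L] by (simp add: AutoGroup_def BijGroup_def)
      then have "(\<lambda>x\<in>carrier K. x) z \<in> ?O" "g z \<in> ?O" using g unfolding orbit_def
        by (auto intro: exI[of _ "\<lambda>x\<in>carrier K. x"] exI[of _ g] simp del: restrict_apply)
      then have "z \<in> ?O" "g z \<in> ?O" using z by auto
      moreover have "?O \<in> orbits (?A\<lparr>carrier := base_group H K\<rparr>) (carrier K) (\<lambda>g. g)"
        unfolding orb[symmetric] using z by (auto simp: orbits_def)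
      ultimately obtain w where w: "w \<in> carrier K"
        "z \<in> orbit (?A\<lparr>carrier := base_group H K\<rparr>) (\<lambda>g. g) w"
        "g z \<in> orbit (?A\<lparr>carrier := base_group H K\<rparr>) (\<lambda>g. g) w"
        unfolding orbits_def by auto
      then obtain a b where ab: "a \<in> H" "b \<in> H" "z = w \<otimes> a" "g z = w \<otimes> b"
        by (auto simp: orbit_def base_group_def)
      obtain a' where a': "a' \<in> H" "a \<otimes> a' = \<one>" using H_inverse[OF ab(1)] by blast
      have c: "a \<in> carrier K" "b \<in> carrier K" "a' \<in> carrier K" using ab a' H_closed by auto
      \<comment> \<open>The orbit comes with its own representative \<open>w\<close>; the element
        \<open>a' \<otimes> b\<close> leads from \<open>z\<close> back to \<open>w\<close> and on to
        \<open>g z\<close>.\<close>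
      have "z \<otimes> (a' \<otimes> b) = w \<otimes> ((a \<otimes> a') \<otimes> b)"
        unfolding ab(3) using c w by (simp add: m_assoc)
      then have "g z = z \<otimes> (a' \<otimes> b)" using ab a' c by simp
      then show ?thesis using H_mult a' ab by blast
    qed
    have "g \<in> scheme_Aut (Cyc H K)"
      using img by (intro scheme_AutI B) (metis gminus minus_closed)
    moreover have "g \<zero> = \<zero>" using img[OF zero_in] H_closed l_zero_mult by auto
    ultimately show "g \<in> base_group H K" by (simp add: base_group_eq_stabilizer)
  qed
qed

end

section \<open>Two schemes on one linear space: isomorphism and conjugacy\<close>

locale cyclotomic_pair =
  C: imprimitive_cyclotomic K H + C': imprimitive_cyclotomic K' H'
  for K :: "('a, 'm) ring_scheme" (structure) and H and K' :: "('a, 'n) ring_scheme" and H' +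
  assumes carrier_eq: "carrier K' = carrier K"
    and add_eq: "\<lbrakk>x \<in> carrier K; y \<in> carrier K\<rbrakk> \<Longrightarrow> x \<oplus>\<^bsub>K'\<^esub> y = x \<oplus> y"
begin

text \<open>The locale compares carriers and sums only. The zero of \<open>K'\<close> is idempotent
  under the common addition, which identifies it with the zero of \<open>K\<close>.\<close>

lemma zero_eq: "\<zero>\<^bsub>K'\<^esub> = \<zero>"
  using C.add_right_idem[of "\<zero>\<^bsub>K'\<^esub>"] C'.zero_in C'.l_zero[of "\<zero>\<^bsub>K'\<^esub>"] add_eq carrier_eq by simp

lemma minus_eq: "\<lbrakk>x \<in> carrier K; y \<in> carrier K\<rbrakk> \<Longrightarrow> x \<ominus>\<^bsub>K'\<^esub> y = x \<ominus> y"
  using C.add.inv_equality[of "\<ominus>\<^bsub>K'\<^esub> y" y] C'.l_neg[of y] C'.neg_in[of y] add_eq carrier_eq zero_eq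
  by (simp add: a_minus_def)

text \<open>Allows results on isomorphisms from the first scheme to be applied to their
  inverses.\<close>

lemma swap: "cyclotomic_pair K' H' K H"
  by (intro cyclotomic_pair.intro cyclotomic_pair_axioms.intro
      C.imprimitive_cyclotomic_axioms C'.imprimitive_cyclotomic_axioms)
    (auto simp: carrier_eq add_eq)

lemma Cyc_fst: "fst (Cyc H K) = carrier K" "fst (Cyc H' K') = carrier K"
  by (simp_all add: Cyc_def carrier_eq)

lemma isomorphism_conj_stabilizer:
  assumes f: "bij_betw f (carrier K) (carrier K)" "rel_image f ` snd (Cyc H K) = snd (Cyc H' K')"
    and f0: "f \<zero> = \<zero>" and g: "g \<in> base_group H K"
  shows "(\<lambda>x\<in>carrier K. f (g (inv_into (carrier K) f x))) \<in> base_group H' K'"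
proof -
  have g': "g \<in> scheme_Aut (Cyc H K)" "g \<zero> = \<zero>" using g by (auto simp: C.base_group_eq_stabilizer)
  have "inv_into (carrier K) f \<zero> = \<zero>" using f(1) f0 C.zero_in by (metis bij_betw_inv_into_left)
  then show ?thesis
    using scheme_Aut_conj[OF _ f(2) C.cyc_rel_subset g'(1)] f(1) f0 g'(2)
    by (simp add: C'.base_group_eq_stabilizer Cyc_fst zero_eq)
qed

text \<open>The conjugate of a translation is an automorphism of the second scheme, hence affine. A
  nonzero translation has no fixed point, which excludes a multiplier other than one, so the
  conjugate is again a translation.\<close>

lemma isomorphism_additive:
  assumes f: "bij_betw f (carrier K) (carrier K)" "rel_image f ` snd (Cyc H K) = snd (Cyc H' K')"
    and f0: "f \<zero> = \<zero>" and x: "x \<in> carrier K" and c: "c \<in> carrier K"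
  shows "f (x \<oplus> c) = f x \<oplus> f c"
proof (cases "c = \<zero>")
  case True
  then show ?thesis using f f0 x bij_betwE by fastforce
next
  case False
  have fc: "f y \<in> carrier K" if "y \<in> carrier K" for y using f(1) that bij_betwE by blast
  let ?t = "\<lambda>y\<in>carrier K. y \<otimes> \<one> \<oplus> c"
  have "(\<lambda>y\<in>carrier K. f (?t (inv_into (carrier K) f y))) \<in> scheme_Aut (Cyc H' K')"
    using scheme_Aut_conj[OF _ f(2) C.cyc_rel_subset C.affine_in_scheme_Aut[OF C.H_one c]] f(1)
    by (simp add: Cyc_fst)
  then obtain b d where b: "b \<in> H'" and d: "d \<in> carrier K"
    and eq: "(\<lambda>y\<in>carrier K. f (?t (inv_into (carrier K) f y))) = (\<lambda>y\<in>carrier K. y \<otimes>\<^bsub>K'\<^esub> b \<oplus>\<^bsub>K'\<^esub> d)"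
    unfolding C'.scheme_Aut_eq_affine carrier_eq by blast
  have bc: "b \<in> carrier K'" using b C'.H_closed by blast
  have shift: "f (y \<oplus> c) = f y \<otimes>\<^bsub>K'\<^esub> b \<oplus>\<^bsub>K'\<^esub> d" if y: "y \<in> carrier K" for y
    using fun_cong[OF eq, of "f y"] y fc f(1) by (simp add: bij_betw_inv_into_left)
  have "b = \<one>\<^bsub>K'\<^esub>"
  proof (rule ccontr)
    assume "b \<noteq> \<one>\<^bsub>K'\<^esub>"
    \<comment> \<open>A fixed point of the affine map with multiplier \<open>b\<close> and
      translation part \<open>d\<close>; its preimage under \<open>f\<close> would be fixed by
      adding \<open>c\<close>.\<close>
    with bc d obtain u where u: "u \<in> carrier K'" "u \<ominus>\<^bsub>K'\<^esub> u \<otimes>\<^bsub>K'\<^esub> b = d"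
      using C'.one_minus_mult_surj[of "carrier K'" b d] carrier_eq by (metis C'.minus_closed C'.m_closed subset_refl)
    obtain y where y: "y \<in> carrier K" "u = f y"
      using u f(1) carrier_eq by (metis bij_betw_inv_into_right inv_into_into bij_betw_imp_surj_on)
    have "f (y \<oplus> c) = d \<oplus>\<^bsub>K'\<^esub> u \<otimes>\<^bsub>K'\<^esub> b"
      using shift[OF y(1)] y(2) C'.a_comm[of d "u \<otimes>\<^bsub>K'\<^esub> b"] C'.m_closed[OF u(1) bc] d carrier_eq by simp
    also have "\<dots> = u" using C'.minus_add_cancel[of u "u \<otimes>\<^bsub>K'\<^esub> b"] u bc by simp
    finally have "y \<oplus> c = y" using f(1) y c C.add_closed by (metis bij_betw_inv_into_left)
    then show False using False y c by simp
  qed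
  then have sh: "f (y \<oplus> c) = f y \<oplus> d" if "y \<in> carrier K" for y
    using shift that fc d carrier_eq by (simp add: add_eq)
  have "f c = d" using sh[of \<zero>] c d f0 by simp
  then show ?thesis using sh x by simp
qed

text \<open>An arbitrary isomorphism is followed by the translation carrying the image of zero to
  zero. That translation preserves each relation of the second scheme.\<close>

lemma normalized_isomorphism:
  assumes "scheme_isomorphic (Cyc H K) (Cyc H' K')"
  obtains f where "f \<in> Bij (carrier K)" "rel_image f ` snd (Cyc H K) = snd (Cyc H' K')" "f \<zero> = \<zero>"
proof -
  from assms obtain f where f: "bij_betw f (carrier K) (carrier K)"
    "rel_image f ` snd (Cyc H K) = snd (Cyc H' K')"
    by (auto simp: scheme_isomorphic_def Cyc_fst)
  have fc: "f y \<in> carrier K" if "y \<in> carrier K" for y using f(1) that bij_betwE by blast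
  let ?c = "\<ominus>\<^bsub>K'\<^esub> f \<zero>"
  have c: "?c \<in> carrier K'" using fc[OF C.zero_in] carrier_eq C'.neg_in by simp
  let ?t = "\<lambda>y\<in>carrier K'. y \<otimes>\<^bsub>K'\<^esub> \<one>\<^bsub>K'\<^esub> \<oplus>\<^bsub>K'\<^esub> ?c"
  have t: "?t \<in> scheme_Aut (Cyc H' K')" by (rule C'.affine_in_scheme_Aut[OF C'.H_one c])
  let ?f = "restrict (?t \<circ> f) (carrier K)"
  show thesis
  proof
    have "bij_betw (?t \<circ> f) (carrier K) (carrier K)"
      using t f(1) by (intro bij_betw_trans[OF f(1)]) (simp add: scheme_Aut_def Bij_def Cyc_fst)
    then show "?f \<in> Bij (carrier K)" by (simp add: Bij_def)
    have "rel_image ?f R = rel_image f R" if R: "R \<in> snd (Cyc H K)" for R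
    proof -
      have "rel_image ?f R = rel_image ?t (rel_image f R)"
        unfolding rel_image_comp
        using C.cyc_rel_subset[OF R] by (intro rel_image_cong[of R "carrier K"]) (auto simp: Cyc_fst)
      also have "\<dots> = rel_image f R" using t f(2) R by (auto simp: scheme_Aut_def)
      finally show ?thesis .
    qed
    then show "rel_image ?f ` snd (Cyc H K) = snd (Cyc H' K')"
      unfolding f(2)[symmetric] by (rule image_cong[OF refl])
    show "?f \<zero> = \<zero>"
      using fc[OF C.zero_in] carrier_eq C'.r_neg zero_eq by simp
  qed
qed

text \<open>Conjugation matches multiplication by \<open>k\<close> with multiplication by some
  \<open>k'\<close>, so \<open>h\<close> carries the coset of \<open>a\<close> under
  \<open>H\<close> onto that of \<open>h a\<close> under \<open>H'\<close>. Additivity lifts this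
  from differences to relations.\<close>

lemma additive_conj_imp_isomorphic:
  assumes h: "h \<in> auto (add_monoid K)"
    and conj: "\<And>g'. g' \<in> base_group H' K' \<longleftrightarrow>
      (\<exists>g\<in>base_group H K. g' = (\<lambda>x\<in>carrier K. h (g (inv_into (carrier K) h x))))"
  shows "scheme_isomorphic (Cyc H K) (Cyc H' K')"
proof -
  have B: "h \<in> Bij (carrier K)" using h by (simp add: auto_def)
  then have bij: "bij_betw h (carrier K) (carrier K)" by (simp add: Bij_def)
  have hc: "h x \<in> carrier K" if "x \<in> carrier K" for x using Bij_imp_funcset[OF B] that by auto
  have hadd: "h (x \<oplus> y) = h x \<oplus> h y" if "x \<in> carrier K" "y \<in> carrier K" for x y
    using h that by (auto simp: auto_def hom_def)
  have hminus: "h (y \<ominus> x) = h y \<ominus> h x" if "x \<in> carrier K" "y \<in> carrier K" for x y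
    using that hadd C.additive_neg[of h x] hc by (simp add: a_minus_def)
  \<comment> \<open>The multiplier \<open>k'\<close> depends on \<open>k\<close> alone, as it comes
    from an equality of whole functions.\<close>
  have fwd: "\<exists>k'\<in>H'. \<forall>a\<in>carrier K. h (a \<otimes> k) = h a \<otimes>\<^bsub>K'\<^esub> k'" if k: "k \<in> H" for k
  proof -
    have "(\<lambda>x\<in>carrier K. x \<otimes> k) \<in> base_group H K" using k by (auto simp: base_group_def)
    then have "(\<lambda>x\<in>carrier K. h ((\<lambda>x\<in>carrier K. x \<otimes> k) (inv_into (carrier K) h x))) \<in> base_group H' K'"
      unfolding conj by blast
    then obtain k' where k': "k' \<in> H'" "(\<lambda>x\<in>carrier K. h ((\<lambda>x\<in>carrier K. x \<otimes> k) (inv_into (carrier K) h x)))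
        = (\<lambda>x\<in>carrier K. x \<otimes>\<^bsub>K'\<^esub> k')" unfolding base_group_def carrier_eq by blast
    have "h (a \<otimes> k) = h a \<otimes>\<^bsub>K'\<^esub> k'" if "a \<in> carrier K" for a
      using fun_cong[OF k'(2), of "h a"] that hc bij by (simp add: bij_betw_inv_into_left)
    then show ?thesis using k' by blast
  qed
  have bwd: "\<exists>k\<in>H. \<forall>a\<in>carrier K. h (a \<otimes> k) = h a \<otimes>\<^bsub>K'\<^esub> k'" if k': "k' \<in> H'" for k'
  proof -
    have "(\<lambda>x\<in>carrier K. x \<otimes>\<^bsub>K'\<^esub> k') \<in> base_group H' K'"
      using k' unfolding base_group_def carrier_eq by blast
    then obtain g where g: "g \<in> base_group H K" "(\<lambda>x\<in>carrier K. x \<otimes>\<^bsub>K'\<^esub> k') =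
        (\<lambda>x\<in>carrier K. h (g (inv_into (carrier K) h x)))" unfolding conj by blast
    then obtain k where k: "k \<in> H" "g = (\<lambda>x\<in>carrier K. x \<otimes> k)" unfolding base_group_def by blast
    have "h (a \<otimes> k) = h a \<otimes>\<^bsub>K'\<^esub> k'" if "a \<in> carrier K" for a
      using fun_cong[OF g(2), of "h a"] that hc bij k by (simp add: bij_betw_inv_into_left)
    then show ?thesis using k by blast
  qed
  have rel: "rel_image h (cyc_rel H K a) = cyc_rel H' K' (h a)" if a: "a \<in> carrier K" for a
  proof (intro equalityI subrelI)
    fix u v assume "(u, v) \<in> rel_image h (cyc_rel H K a)"
    then obtain x y k where xy: "u = h x" "v = h y" "x \<in> carrier K" "y \<in> carrier K" "k \<in> H" "y \<ominus> x = a \<otimes> k"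
      by (auto simp: rel_image_def C.cyc_rel_iff)
    obtain k' where k': "k' \<in> H'" "h (a \<otimes> k) = h a \<otimes>\<^bsub>K'\<^esub> k'" using fwd[OF xy(5)] a by blast
    have "v \<ominus>\<^bsub>K'\<^esub> u = h a \<otimes>\<^bsub>K'\<^esub> k'"
      using xy hc hminus k' by (metis minus_eq)
    then show "(u, v) \<in> cyc_rel H' K' (h a)" using xy hc k' by (auto simp: C'.cyc_rel_iff carrier_eq)
  next
    fix u v assume "(u, v) \<in> cyc_rel H' K' (h a)"
    then obtain k' where k': "u \<in> carrier K" "v \<in> carrier K" "k' \<in> H'" "v \<ominus>\<^bsub>K'\<^esub> u = h a \<otimes>\<^bsub>K'\<^esub> k'"
      by (auto simp: C'.cyc_rel_iff carrier_eq)
    then obtain x y where xy: "u = h x" "v = h y" "x \<in> carrier K" "y \<in> carrier K"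
      using bij unfolding bij_betw_def by blast
    obtain k where k: "k \<in> H" "h (a \<otimes> k) = h a \<otimes>\<^bsub>K'\<^esub> k'" using bwd[OF k'(3)] a by blast
    have "h (y \<ominus> x) = h (a \<otimes> k)" using xy hminus k k' minus_eq by metis
    then have "y \<ominus> x = a \<otimes> k"
      using bij xy a k C.H_closed by (metis C.minus_closed C.m_closed bij_betw_inv_into_left)
    then have "(x, y) \<in> cyc_rel H K a" using xy k by (auto simp: C.cyc_rel_iff)
    then show "(u, v) \<in> rel_image h (cyc_rel H K a)" using xy by (auto simp: rel_image_def)
  qed
  have "rel_image h ` snd (Cyc H K) = (\<lambda>a. cyc_rel H' K' (h a)) ` carrier K"
    unfolding Cyc_def snd_conv image_image using rel by (intro image_cong) auto
  also have "\<dots> = cyc_rel H' K' ` (h ` carrier K)" by (simp add: image_image)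
  also have "h ` carrier K = carrier K'" using bij carrier_eq by (simp add: bij_betw_def)
  finally have "rel_image h ` snd (Cyc H K) = snd (Cyc H' K')" by (simp add: Cyc_def)
  then show ?thesis using bij unfolding scheme_isomorphic_def Cyc_fst by blast
qed

text \<open>Connects the coset product in \<open>conjugate_in\<close> with the pointwise conjugates
  of \<open>scheme_Aut_conj\<close>; the link is \<open>k_eq\<close>, where the group inverse of
  \<open>h\<close> agrees with \<open>inv_into\<close> on the carrier.\<close>

lemma conj_eq:
  assumes h: "h \<in> auto (add_monoid K)"
  defines "G \<equiv> AutoGroup (add_monoid K)"
  shows "h <#\<^bsub>G\<^esub> base_group H K #>\<^bsub>G\<^esub> (inv\<^bsub>G\<^esub> h)
    = (\<lambda>g. \<lambda>x\<in>carrier K. h (g (inv_into (carrier K) h x))) ` base_group H K"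
proof -
  have A: "group G" unfolding G_def by (rule group.AutoGroup[OF C.add_group])
  have B: "auto (add_monoid K) \<subseteq> Bij (carrier K)" by (auto simp: auto_def)
  have car: "carrier G = auto (add_monoid K)" by (simp add: G_def AutoGroup_def)
  have mult: "f \<otimes>\<^bsub>G\<^esub> g = compose (carrier K) f g" if "f \<in> carrier G" "g \<in> carrier G" for f g
    using that B unfolding car by (auto simp: G_def AutoGroup_def BijGroup_def)
  have one: "\<one>\<^bsub>G\<^esub> = (\<lambda>x\<in>carrier K. x)" by (simp add: G_def AutoGroup_def BijGroup_def)
  define k where "k = inv\<^bsub>G\<^esub> h"
  have hG: "h \<in> carrier G" using h car by simp
  have kG: "k \<in> carrier G" using group.inv_closed[OF A hG] by (simp add: k_def)
  have hk: "compose (carrier K) h k = (\<lambda>x\<in>carrier K. x)"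
    using group.r_inv[OF A hG] mult[OF hG kG] one by (simp add: k_def)
  have kB: "k \<in> Bij (carrier K)" using kG B unfolding car by blast
  have kc: "k x \<in> carrier K" if "x \<in> carrier K" for x using Bij_imp_funcset[OF kB] that by auto
  have k_eq: "k x = inv_into (carrier K) h x" if x: "x \<in> carrier K" for x
  proof -
    have "h (k x) = x" using fun_cong[OF hk, of x] x by (simp add: compose_eq)
    moreover have "inj_on h (carrier K)" using h B by (auto simp: Bij_def bij_betw_def)
    ultimately show ?thesis using inv_into_f_f[OF _ kc[OF x]] by metis
  qed
  have "(h \<otimes>\<^bsub>G\<^esub> g) \<otimes>\<^bsub>G\<^esub> k = (\<lambda>x\<in>carrier K. h (g (inv_into (carrier K) h x)))"
    if g: "g \<in> base_group H K" for g
  proof -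
    have gG: "g \<in> carrier G" using g subgroup.subset[OF C.subgroup_base_group] by (auto simp: G_def)
    have hg: "h \<otimes>\<^bsub>G\<^esub> g \<in> carrier G" using A gG hG by (simp add: group.is_monoid monoid.m_closed)
    have "(h \<otimes>\<^bsub>G\<^esub> g) \<otimes>\<^bsub>G\<^esub> k = compose (carrier K) (compose (carrier K) h g) k"
      using mult[OF hg kG] mult[OF hG gG] by simp
    then show ?thesis
      unfolding compose_def using kc k_eq by (auto intro!: restrict_ext)
  qed
  then show ?thesis by (auto simp: l_coset_def r_coset_def k_def)
qed

lemma isomorphic_iff_conjugate:
  "scheme_isomorphic (Cyc H K) (Cyc H' K') \<longleftrightarrow>
    conjugate_in (GL (prime_field K) (linear_space K)) (base_group H K) (base_group H' K')"
proof
  interpret S: cyclotomic_pair K' H' K H by (rule swap)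
  assume "scheme_isomorphic (Cyc H K) (Cyc H' K')"
  then obtain f where fB: "f \<in> Bij (carrier K)" and f2: "rel_image f ` snd (Cyc H K) = snd (Cyc H' K')"
    and f0: "f \<zero> = \<zero>" by (rule normalized_isomorphism)
  have f1: "bij_betw f (carrier K) (carrier K)" using fB by (simp add: Bij_def)
  have fa: "f \<in> auto (add_monoid K)"
    using fB isomorphism_additive[OF f1 f2 f0] Bij_imp_funcset[OF fB] by (auto simp: auto_def hom_def)
  let ?i = "inv_into (carrier K) f"
  have i: "bij_betw ?i (carrier K') (carrier K')" "rel_image ?i ` snd (Cyc H' K') = snd (Cyc H K)"
    using bij_betw_inv_into[OF f1] rel_image_inv_into[OF _ f2 C.cyc_rel_subset] f1
    by (simp_all add: carrier_eq Cyc_fst)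
  have i0: "?i \<zero>\<^bsub>K'\<^esub> = \<zero>\<^bsub>K'\<^esub>" using f1 f0 C.zero_in zero_eq by (metis bij_betw_inv_into_left)
  have "base_group H' K' = (\<lambda>g. \<lambda>x\<in>carrier K. f (g (?i x))) ` base_group H K"
  proof (intro equalityI subsetI)
    fix g' assume "g' \<in> (\<lambda>g. \<lambda>x\<in>carrier K. f (g (?i x))) ` base_group H K"
    then show "g' \<in> base_group H' K'" using isomorphism_conj_stabilizer[OF f1 f2 f0] by auto
  next
    fix g' assume g': "g' \<in> base_group H' K'"
    \<comment> \<open>Pulls \<open>g'\<close> back along \<open>f\<close>: conjugation by the
      inverse isomorphism \<open>?i\<close>, whose own inverse agrees with \<open>f\<close> on the
      carrier.\<close>
    let ?g = "\<lambda>x\<in>carrier K. ?i (g' (inv_into (carrier K) ?i x))"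
    have "?g \<in> base_group H K"
      using S.isomorphism_conj_stabilizer[OF i i0 g'] by (simp add: carrier_eq)
    moreover have "g' = (\<lambda>x\<in>carrier K. f (?g (?i x)))"
    proof
      fix x
      have g'B: "g' \<in> Bij (carrier K)"
        using g' by (simp add: C'.base_group_eq_stabilizer scheme_Aut_def Cyc_fst)
      show "g' x = (\<lambda>x\<in>carrier K. f (?g (?i x))) x"
      proof (cases "x \<in> carrier K")
        case True
        have "inv_into (carrier K) ?i (?i x) = x"
          using bij_betw_inv_into[OF f1] True by (simp add: bij_betw_inv_into_left)
        moreover have "?i x \<in> carrier K" "g' x \<in> carrier K"
          using bij_betwE[OF bij_betw_inv_into[OF f1]] Bij_imp_funcset[OF g'B] True by auto
        ultimately show ?thesis using True f1 by (simp add: bij_betw_inv_into_right)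
      next
        case False
        then show ?thesis using Bij_imp_extensional[OF g'B] by (simp add: extensional_def)
      qed
    qed
    ultimately show "g' \<in> (\<lambda>g. \<lambda>x\<in>carrier K. f (g (?i x))) ` base_group H K" by blast
  qed
  then show "conjugate_in (GL (prime_field K) (linear_space K)) (base_group H K) (base_group H' K')"
    unfolding conjugate_in_def C.GL_eq_AutoGroup
    using fa conj_eq[OF fa] by (intro bexI[of _ f]) (auto simp: AutoGroup_def)
next
  assume "conjugate_in (GL (prime_field K) (linear_space K)) (base_group H K) (base_group H' K')"
  then obtain h where h: "h \<in> auto (add_monoid K)"
    and eq: "base_group H' K' = h <#\<^bsub>AutoGroup (add_monoid K)\<^esub> base_group H K
      #>\<^bsub>AutoGroup (add_monoid K)\<^esub> (inv\<^bsub>AutoGroup (add_monoid K)\<^esub> h)"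
    unfolding conjugate_in_def C.GL_eq_AutoGroup by (auto simp: AutoGroup_def)
  show "scheme_isomorphic (Cyc H K) (Cyc H' K')"
    by (rule additive_conj_imp_isomorphic[OF h]) (auto simp: eq conj_eq[OF h])
qed

end

theorem corollary3p6:
  fixes K :: "('a, 'm) ring_scheme" and K' :: "('a, 'n) ring_scheme"
    and H H' :: "'a set"
  assumes "near_field K" and "finite (carrier K)"
    and "near_field K'" and "finite (carrier K')"
    and "carrier K = carrier K'"
    and "\<And>x y. \<lbrakk>x \<in> carrier K; y \<in> carrier K\<rbrakk> \<Longrightarrow> x \<oplus>\<^bsub>K\<^esub> y = x \<oplus>\<^bsub>K'\<^esub> y"
    and "subgroup H (Multiplicative_Group.mult_of K)" and "subgroup H' (Multiplicative_Group.mult_of K')"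
    and "imprimitive (Cyc H K)" and "imprimitive (Cyc H' K')"
  shows "(scheme_isomorphic (Cyc H K) (Cyc H' K') \<longleftrightarrow>
      conjugate_in (GL (prime_field K) (linear_space K)) (base_group H K) (base_group H' K'))
    \<and> linear_closure (prime_field K) (linear_space K) (base_group H K) = base_group H K
    \<and> scheme_Aut (Cyc H K) =
        translation_group (linear_space K) <#>\<^bsub>BijGroup (carrier K)\<^esub> base_group H K"
proof -
  interpret cyclotomic_pair K H K' H'
    using assms
    by (intro cyclotomic_pair.intro cyclotomic_pair_axioms.intro imprimitive_cyclotomic.intro
        imprimitive_cyclotomic_axioms.intro cyclotomic.intro cyclotomic_axioms.intro
        finite_near_field.intro finite_near_field_axioms.intro) simp_all
  show ?thesis
    using isomorphic_iff_conjugate C.linear_closure_base_group C.scheme_Aut_eq_set_mult by blast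
qed

end
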